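(* Let $\mathfrak{g}_2$ be the real 3-dimensional Lie algebra with basis $e_1,e_2,e_3$ and brackets $[e_1,e_3]=0$, $[e_2,e_3]=0$, $[e_1,e_2]=e_1$. Each integrable complex structure $\mathcal{J}$ on $\mathfrak{g}_2\times\mathfrak{g}_2$ is, in some standard basis $(e_1,e_2,e_3,e_1^*,e_2^*,e_3^* )$ of $\mathfrak{g}_2\times\mathfrak{g}_2$, given by the matrix $$ \left[ \begin{array}{cccccc} X & \frac{-1-X^2}{Y} & 0 & 0 & 0 & 0\\ Y & -X & 0 & 0 & 0 & 0\\ \kappa(\lambda-X) & \kappa \frac{1+X^2}{Y} & \lambda & \kappa^*(-1-\lambda^2) & 0 & -1-\lambda^2\\ 0 & 0 & 0 & X^* & \frac{-1-(X^* )^2}{Y^*} & 0\\ 0 & 0 & 0 & Y^* & -X^* & 0\\ \kappa & 0 & 1 & \kappa^*(-\lambda-X^* ) & \kappa^* \frac{1+(X^* )^2}{Y^*} & -\lambda \end{array} \right] $$ for some real numbers $\lambda, X, X^*, \kappa, \kappa^*$ and non-zero real numbers $Y$ and $Y^*$. Conversely, any such choice of numbers provides an integrable complex structure on $\mathfrak{g}_2\times\mathfrak{g}_2$.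
   Context: For a real Lie algebra $\mathfrak{g}$, the product $\mathfrak{g}\times\mathfrak{g}$ carries the componentwise bracket. Write $\mathfrak{g}=\mathfrak{g}\times 0$ and $\mathfrak{g}^*=0\times\mathfrak{g}$ (the asterisk only marks the second copy; it is not a dual space), and mark vectors of the second factor with an asterisk, so $[u+u^*,v+v^*]=[u,v]+[u^*,v^*]$. An integrable complex structure on $\mathfrak{g}\times\mathfrak{g}$ is a real-linear map $\mathcal{J}:\mathfrak{g}\times\mathfrak{g}\to\mathfrak{g}\times\mathfrak{g}$ with $\mathcal{J}^2=-\mathrm{id}$ and $[v,w]+\mathcal{J}[\mathcal{J}v,w]+\mathcal{J}[v,\mathcal{J}w]-[\mathcal{J}v,\mathcal{J}w]=0$ for all $v,w\in\mathfrak{g}\times\mathfrak{g}$. A standard basis of $\mathfrak{g}_2\times\mathfrak{g}_2$ is an ordered basis $(e_1,e_2,e_3,e_1^*,e_2^*,e_3^* )$ such that $e_1,e_2,e_3$ is a basis of the first factor satisfying $[e_1,e_3]=0$, $[e_2,e_3]=0$, $[e_1,e_2]=e_1$, and $e_1^*,e_2^*,e_3^*$ is a basis of the second factor satisfying $[e_1^*,e_3^*]=0$, $[e_2^*,e_3^*]=0$, $[e_1^*,e_2^*]=e_1^*$. Matrices act on column vectors: the $j$-th column contains the coordinates of the image under $\mathcal{J}$ of the $j$-th basis vector. The symbols $X^*,Y^*,\kappa^*$ denote real numbers independent of $X,Y,\kappa$. *)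

theory Defs
  imports "HOL-Analysis.Analysis"
begin

definition lie_bracket :: "('g::real_vector \<Rightarrow> 'g \<Rightarrow> 'g) \<Rightarrow> bool" where
  "lie_bracket br \<longleftrightarrow>
     bilinear br \<and> (\<forall>x. br x x = 0) \<and>
     (\<forall>x y z. br x (br y z) + br y (br z x) + br z (br x y) = 0)"

definition prod_bracket ::
    "('g::real_vector \<Rightarrow> 'g \<Rightarrow> 'g) \<Rightarrow> 'g \<times> 'g \<Rightarrow> 'g \<times> 'g \<Rightarrow> 'g \<times> 'g" where
  "prod_bracket br v w = (br (fst v) (fst w), br (snd v) (snd w))"

definition g2_basis ::
    "('a::real_vector \<Rightarrow> 'a \<Rightarrow> 'a) \<Rightarrow> 'a set \<Rightarrow> 'a \<Rightarrow> 'a \<Rightarrow> 'a \<Rightarrow> bool" where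
  "g2_basis br S e1 e2 e3 \<longleftrightarrow>
     distinct [e1, e2, e3] \<and> independent {e1, e2, e3} \<and> span {e1, e2, e3} = S \<and>
     br e1 e3 = 0 \<and> br e2 e3 = 0 \<and> br e1 e2 = e1"

text \<open>The Lie algebra is fixed up to isomorphism only: any real vector space with a Lie
  bracket and a basis satisfying the defining relations is admitted.\<close>

definition is_g2 :: "('g::real_vector \<Rightarrow> 'g \<Rightarrow> 'g) \<Rightarrow> bool" where
  "is_g2 br \<longleftrightarrow> lie_bracket br \<and> (\<exists>e1 e2 e3. g2_basis br UNIV e1 e2 e3)"

lemma is_g2_model:
  "is_g2 (\<lambda>(a, b, c) (a', b', c'). (a * b' - b * a', 0, 0) :: real \<times> real \<times> real)"
    (is "is_g2 ?br")
proof -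
  have "lie_bracket ?br"
    unfolding lie_bracket_def bilinear_def
    by (auto intro!: linearI simp: algebra_simps zero_prod_def)
  moreover have "g2_basis ?br UNIV (1, 0, 0) (0, 1, 0) (0, 0, 1)"
  proof -
    have "(a, b, c) \<in> span {(1, 0, 0), (0, 1, 0), (0, 0, 1)}" for a b c :: real
    proof -
      have "(a, b, c) = a *\<^sub>R (1, 0, 0) + b *\<^sub>R (0, 1, 0) + c *\<^sub>R (0, 0, 1)"
        by simp
      also have "\<dots> \<in> span {(1, 0, 0), (0, 1, 0), (0, 0, 1)}"
        by (intro span_add span_scale span_base) auto
      finally show ?thesis .
    qed
    then have sp: "span {(1, 0, 0), (0, 1, 0), (0, 0, 1)} = (UNIV :: (real \<times> real \<times> real) set)"
      by auto
    have "independent {(1, 0, 0), (0, 1, 0), (0, 0, 1 :: real) :: real \<times> real \<times> real}"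
      by (rule card_le_dim_spanning[where V = UNIV]) (use sp in auto)
    with sp show ?thesis
      by (simp add: g2_basis_def zero_prod_def)
  qed
  ultimately show ?thesis
    unfolding is_g2_def by blast
qed

text \<open>Ordered six-tuples are indexed by the numeral type \<open>6\<close>, with indices \<open>1, \<dots>, 6\<close>
  (where \<open>6 = 0\<close> in that type); this is also the order in which \<^const>\<open>vector\<close> enumerates
  its entries. The vectors of the second copy have the indices 4, 5, 6.\<close>

definition standard_basis ::
    "('g::real_vector \<Rightarrow> 'g \<Rightarrow> 'g) \<Rightarrow> (6 \<Rightarrow> 'g \<times> 'g) \<Rightarrow> bool" where
  "standard_basis br b \<longleftrightarrow>
     g2_basis (prod_bracket br) (UNIV \<times> {0}) (b 1) (b 2) (b 3) \<and>
     g2_basis (prod_bracket br) ({0} \<times> UNIV) (b 4) (b 5) (b 6)"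

definition integrable_complex_structure ::
    "('a::real_vector \<Rightarrow> 'a \<Rightarrow> 'a) \<Rightarrow> ('a \<Rightarrow> 'a) \<Rightarrow> bool" where
  "integrable_complex_structure br J \<longleftrightarrow>
     linear J \<and> (\<forall>v. J (J v) = - v) \<and>
     (\<forall>v w. br v w + J (br (J v) w) + J (br v (J w)) - br (J v) (J w) = 0)"

definition has_matrix ::
    "('a::real_vector \<Rightarrow> 'a) \<Rightarrow> ('n::finite \<Rightarrow> 'a) \<Rightarrow> real^'n^'n \<Rightarrow> bool" where
  "has_matrix J b M \<longleftrightarrow> (\<forall>j. J (b j) = (\<Sum>i\<in>UNIV. M $ i $ j *\<^sub>R b i))"

definition g2_matrix ::
    "real \<Rightarrow> real \<Rightarrow> real \<Rightarrow> real \<Rightarrow> real \<Rightarrow> real \<Rightarrow> real \<Rightarrow> real^6^6" where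
  "g2_matrix l X Y k X' Y' k' = vector
    [vector [X, (-1 - X\<^sup>2) / Y, 0, 0, 0, 0],
     vector [Y, - X, 0, 0, 0, 0],
     vector [k * (l - X), k * ((1 + X\<^sup>2) / Y), l, k' * (-1 - l\<^sup>2), 0, -1 - l\<^sup>2],
     vector [0, 0, 0, X', (-1 - X'\<^sup>2) / Y', 0],
     vector [0, 0, 0, Y', - X', 0],
     vector [k, 0, 1, k' * (- l - X'), k' * ((1 + X'\<^sup>2) / Y'), - l]]"

end

(* Modulo the center Z, bracket and Nijenhuis tensor only involve the planes <b1, b2> and <b4, b5>.
   The Nijenhuis identity at (b1, b2) shows that J b1 is never in the span of b1, b4 and Z. At (z, w)
   with z central it reads J [J z, w] = [J z, J w], so J [J z, w] lies in the derived algebra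
   <b1, b4>, which forces J z to be central. At (b1, b4) it then shows that both planes are
   J-invariant modulo Z. The remaining freedom b2 + t b3, b5 + t' b6, m b6 in the choice of a standard
   basis brings J to normal form. Conversely, each 2x2 block acts on its plane modulo Z with
   determinant 1 and trace 0, so [J v, J w] = [v, w] and [J v, w] + [v, J w] = 0. *)

theory Submission
  imports Defs
begin

section \<open>Sums and vectors over the index type \<open>6\<close>\<close>

lemma UNIV_6: "(UNIV::6 set) = {1,2,3,4,5,6}"
proof -
  have "card {1,2,3,4,5,6::6} = CARD(6)" by simp
  then show ?thesis using card_subset_eq[of UNIV "{1,2,3,4,5,6::6}"] by (metis finite subset_UNIV)
qed

lemma sum_6: "(\<Sum>i\<in>UNIV. f (i::6)) = f 1 + f 2 + f 3 + f 4 + f 5 + f 6"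
  unfolding UNIV_6 by (simp add: add.assoc)

lemma forall_6: "(\<forall>i::6. P i) \<longleftrightarrow> P 1 \<and> P 2 \<and> P 3 \<and> P 4 \<and> P 5 \<and> P 6"
  using UNIV_6 by (metis UNIV_I empty_iff insert_iff)

lemma vector_6 [simp]:
  "(vector [x1,x2,x3,x4,x5,x6] :: ('a::zero)^6) $ 1 = x1"
  "(vector [x1,x2,x3,x4,x5,x6] :: ('a::zero)^6) $ 2 = x2"
  "(vector [x1,x2,x3,x4,x5,x6] :: ('a::zero)^6) $ 3 = x3"
  "(vector [x1,x2,x3,x4,x5,x6] :: ('a::zero)^6) $ 4 = x4"
  "(vector [x1,x2,x3,x4,x5,x6] :: ('a::zero)^6) $ 5 = x5"
  "(vector [x1,x2,x3,x4,x5,x6] :: ('a::zero)^6) $ 6 = x6"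
  unfolding vector_def by simp_all

section \<open>Bases of three vectors in terms of coefficients\<close>

lemma independent_3_iff:
  fixes x y z :: "'a::real_vector"
  shows "distinct [x, y, z] \<and> independent {x, y, z} \<longleftrightarrow>
    (\<forall>p q r. p *\<^sub>R x + q *\<^sub>R y + r *\<^sub>R z = 0 \<longrightarrow> p = 0 \<and> q = 0 \<and> r = 0)" (is "?L \<longleftrightarrow> ?R")
proof
  assume L: ?L
  show ?R
  proof (intro allI impI)
    fix p q r assume eq: "p *\<^sub>R x + q *\<^sub>R y + r *\<^sub>R z = 0"
    \<comment> \<open>By distinctness the coefficients form a function on the set, with the values
      \<open>p\<close>, \<open>q\<close>, \<open>r\<close> at \<open>x\<close>, \<open>y\<close>,
      \<open>z\<close>.\<close>
    define u where "u = (\<lambda>v. if v = x then p else if v = y then q else r)"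
    have "(\<Sum>v\<in>{x, y, z}. u v *\<^sub>R v) = 0"
      using L eq by (auto simp: u_def add.assoc)
    then have "\<forall>v\<in>{x, y, z}. u v = 0"
      using L dependent_finite[of "{x, y, z}"] by blast
    then show "p = 0 \<and> q = 0 \<and> r = 0"
      using L by (auto simp: u_def)
  qed
next
  assume R: ?R
  \<comment> \<open>If two of the vectors were equal, their difference would be a relation with
    coefficients 1 and -1.\<close>
  have d: "distinct [x, y, z]"
    using R[rule_format, of 1 "-1" 0] R[rule_format, of 1 0 "-1"] R[rule_format, of 0 1 "-1"] by auto
  moreover have "independent {x, y, z}"
    unfolding dependent_finite[OF finite.insertI[OF finite.insertI[OF finite.insertI[OF finite.emptyI]]]]
    using d R by (auto simp: add.assoc)
  ultimately show ?L ..
qed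

lemma span_3: "span {x, y, z} = {p *\<^sub>R x + q *\<^sub>R y + r *\<^sub>R z |p q r. True}"
proof -
  have "v \<in> span {x, y, z} \<longleftrightarrow> (\<exists>p q r. v = p *\<^sub>R x + q *\<^sub>R y + r *\<^sub>R z)" for v
    by (simp add: span_breakdown_eq eq_diff_eq diff_eq_eq) (simp add: ac_simps)
  then show ?thesis by auto
qed

lemma g2_basis_iff:
  "g2_basis B S x y z \<longleftrightarrow>
    (\<forall>p q r. p *\<^sub>R x + q *\<^sub>R y + r *\<^sub>R z = 0 \<longrightarrow> p = 0 \<and> q = 0 \<and> r = 0) \<and>
    {p *\<^sub>R x + q *\<^sub>R y + r *\<^sub>R z |p q r. True} = S \<and> B x z = 0 \<and> B y z = 0 \<and> B x y = x"
  unfolding g2_basis_def span_3 independent_3_iff[symmetric] by auto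

section \<open>Brackets in the algebra and its square; change of basis\<close>

lemma lie_bracket_bilinear: "lie_bracket B \<Longrightarrow> bilinear B"
  and lie_bracket_self: "lie_bracket B \<Longrightarrow> B x x = 0"
  by (auto simp: lie_bracket_def)

lemma lie_bracket_skew:
  assumes "lie_bracket B" shows "B y x = - B x y"
proof -
  note bl = lie_bracket_bilinear[OF assms]
  have "B (x + y) (x + y) = 0" using assms by (rule lie_bracket_self)
  moreover have "B (x + y) (x + y) = B y x + B x y"
    by (simp add: bilinear_ladd[OF bl] bilinear_radd[OF bl]
        lie_bracket_self[OF assms, of x] lie_bracket_self[OF assms, of y])
  ultimately show ?thesis by (metis eq_neg_iff_add_eq_0)
qed

lemma lie_bracket_prod:
  assumes "lie_bracket B" shows "lie_bracket (prod_bracket B)"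
proof -
  note bl = lie_bracket_bilinear[OF assms]
  have "bilinear (prod_bracket B)"
    unfolding bilinear_def[of "prod_bracket B"] prod_bracket_def
    by (auto intro!: linearI
        simp: bilinear_ladd[OF bl] bilinear_radd[OF bl] bilinear_lmul[OF bl] bilinear_rmul[OF bl])
  then show ?thesis
    using assms unfolding lie_bracket_def by (simp add: prod_bracket_def zero_prod_def)
qed

lemma g2_basis_bracket:
  assumes lie: "lie_bracket B" and "g2_basis B S e1 e2 e3"
  shows "B (p1 *\<^sub>R e1 + p2 *\<^sub>R e2 + p3 *\<^sub>R e3) (q1 *\<^sub>R e1 + q2 *\<^sub>R e2 + q3 *\<^sub>R e3)
    = (p1 * q2 - p2 * q1) *\<^sub>R e1"
proof -
  note bl = lie_bracket_bilinear[OF lie]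
  have e: "B e1 e3 = 0" "B e2 e3 = 0" "B e1 e2 = e1"
    using assms(2) by (auto simp: g2_basis_def)
  then have e': "B e3 e1 = 0" "B e3 e2 = 0" "B e2 e1 = - e1"
    using lie_bracket_skew[OF lie] by (metis minus_zero)+
  show ?thesis
    by (simp add: bilinear_ladd[OF bl] bilinear_radd[OF bl] bilinear_lmul[OF bl] bilinear_rmul[OF bl]
        lie_bracket_self[OF lie] e e' algebra_simps)
qed

text \<open>The relations survive because \<open>e3\<close> commutes with \<open>e1\<close> and
  \<open>e2\<close>. This is the freedom used later to normalise the matrix of
  \<open>J\<close>.\<close>

lemma g2_basis_change:
  assumes lie: "lie_bracket B" and basis: "g2_basis B S e1 e2 e3" and m: "m \<noteq> 0"
  shows "g2_basis B S e1 (e2 + t *\<^sub>R e3) (m *\<^sub>R e3)"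
proof -
  note bl = lie_bracket_bilinear[OF lie]
  have eq: "p *\<^sub>R e1 + q *\<^sub>R (e2 + t *\<^sub>R e3) + r *\<^sub>R m *\<^sub>R e3
    = p *\<^sub>R e1 + q *\<^sub>R e2 + (q * t + r * m) *\<^sub>R e3" for p q r
    by (simp add: algebra_simps)
  \<comment> \<open>The new last coefficient enters by a triangular substitution, invertible since
    \<open>m \<noteq> 0\<close>; so span and independence carry over.\<close>
  have "\<exists>r'. q * t + r' * m = r" for q r
    using m by (intro exI[of _ "(r - q * t) / m"]) simp
  then have "{p *\<^sub>R e1 + q *\<^sub>R e2 + (q * t + r * m) *\<^sub>R e3 |p q r. True}
    = {p *\<^sub>R e1 + q *\<^sub>R e2 + r *\<^sub>R e3 |p q r. True}"
    by (auto; metis)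
  moreover have "B e1 e2 = e1" "B e1 e3 = 0" "B e2 e3 = 0"
    using basis by (auto simp: g2_basis_def)
  moreover have "p = 0 \<and> q = 0 \<and> r = 0"
    if "p *\<^sub>R e1 + q *\<^sub>R e2 + (q * t + r * m) *\<^sub>R e3 = 0" for p q r
  proof -
    have "p = 0 \<and> q = 0 \<and> q * t + r * m = 0"
      using basis that unfolding g2_basis_iff by blast
    then show ?thesis using m by auto
  qed
  ultimately show ?thesis
    using basis unfolding g2_basis_iff eq
    by (auto simp: bilinear_ladd[OF bl] bilinear_radd[OF bl] bilinear_lmul[OF bl]
        bilinear_rmul[OF bl] lie_bracket_self[OF lie])
qed

lemma g2_basis_prod:
  assumes lie: "lie_bracket br" and basis: "g2_basis br UNIV e1 e2 e3"
  shows "standard_basis br (($) (vector [(e1,0), (e2,0), (e3,0), (0,e1), (0,e2), (0,e3)]))"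
proof -
  have z: "br 0 0 = 0" using lie by (rule lie_bracket_self)
  have "\<exists>p q r. v = p *\<^sub>R e1 + q *\<^sub>R e2 + r *\<^sub>R e3" for v
    using basis unfolding g2_basis_iff by blast
  then show ?thesis
    using basis unfolding standard_basis_def g2_basis_iff
    by (auto simp: prod_bracket_def z zero_prod_def)
qed

section \<open>Coordinates with respect to a standard basis\<close>

lemma standard_basis_expand:
  assumes "standard_basis br b"
  shows "\<exists>!x::real^6. (\<Sum>i\<in>UNIV. x $ i *\<^sub>R b i) = v"
proof -
  define s1 where "s1 x = x $ 1 *\<^sub>R b 1 + x $ 2 *\<^sub>R b 2 + x $ 3 *\<^sub>R b 3" for x :: "real^6"
  define s2 where "s2 x = x $ 4 *\<^sub>R b 4 + x $ 5 *\<^sub>R b 5 + x $ 6 *\<^sub>R b 6" for x :: "real^6"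
  have sum: "(\<Sum>i\<in>UNIV. x $ i *\<^sub>R b i) = s1 x + s2 x" for x :: "real^6"
    by (simp add: sum_6 s1_def s2_def)
  have f1: "s1 x = 0 \<Longrightarrow> x $ 1 = 0 \<and> x $ 2 = 0 \<and> x $ 3 = 0"
    and f2: "s2 x = 0 \<Longrightarrow> x $ 4 = 0 \<and> x $ 5 = 0 \<and> x $ 6 = 0" for x
    using assms unfolding standard_basis_def g2_basis_iff s1_def s2_def by metis+
  have S1: "{p *\<^sub>R b 1 + q *\<^sub>R b 2 + r *\<^sub>R b 3 |p q r. True} = UNIV \<times> {0}"
    and S2: "{p *\<^sub>R b 4 + q *\<^sub>R b 5 + r *\<^sub>R b 6 |p q r. True} = {0} \<times> UNIV"
    using assms unfolding standard_basis_def g2_basis_iff by metis+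
  have "(fst v, 0) \<in> {p *\<^sub>R b 1 + q *\<^sub>R b 2 + r *\<^sub>R b 3 |p q r. True}"
    "(0, snd v) \<in> {p *\<^sub>R b 4 + q *\<^sub>R b 5 + r *\<^sub>R b 6 |p q r. True}"
    unfolding S1 S2 by auto
  then obtain p q r p' q' r' where
    "(fst v, 0) = p *\<^sub>R b 1 + q *\<^sub>R b 2 + r *\<^sub>R b 3" "(0, snd v) = p' *\<^sub>R b 4 + q' *\<^sub>R b 5 + r' *\<^sub>R b 6"
    by blast
  then have "s1 (vector [p,q,r,p',q',r']) + s2 (vector [p,q,r,p',q',r']) = (fst v, 0) + (0, snd v)"
    by (simp add: s1_def s2_def)
  moreover have "x = y" if "s1 x + s2 x = s1 y + s2 y" for x y
  proof -
    have "s1 (x - y) + s2 (x - y) = 0"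
      using that by (simp add: s1_def s2_def algebra_simps)
    \<comment> \<open>The two factors meet only in 0, so a vanishing sum of one vector from each has
      vanishing summands.\<close>
    moreover have "s1 (x - y) \<in> UNIV \<times> {0}" "s2 (x - y) \<in> {0} \<times> UNIV"
      unfolding S1[symmetric] S2[symmetric] s1_def s2_def by blast+
    ultimately have "s1 (x - y) = 0" "s2 (x - y) = 0"
      by (auto simp: prod_eq_iff)
    then have "\<forall>i. (x - y) $ i = 0" using f1 f2 unfolding forall_6 by blast
    then show "x = y" by (simp add: vec_eq_iff)
  qed
  ultimately show ?thesis unfolding sum by (intro ex_ex1I) auto
qed

text \<open>Retains of a standard basis only its coordinates and the bracket expressed in them.
  Exchanging the two copies then gives another instance, although the exchanged basis is not a
  standard one.\<close>

locale g2_frame =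
  fixes B :: "'v::real_vector \<Rightarrow> 'v \<Rightarrow> 'v" and b :: "6 \<Rightarrow> 'v" and c :: "'v \<Rightarrow> real^6"
  assumes linear_coord: "linear c"
    and expand: "(\<Sum>i\<in>UNIV. c v $ i *\<^sub>R b i) = v"
    and coord_basis: "c (b i) = axis i 1"
    and bracket: "B v w = (c v $ 1 * c w $ 2 - c v $ 2 * c w $ 1) *\<^sub>R b 1
      + (c v $ 4 * c w $ 5 - c v $ 5 * c w $ 4) *\<^sub>R b 4"

lemma standard_basis_frame:
  assumes lie: "lie_bracket br" and std: "standard_basis br b"
  obtains c where "g2_frame (prod_bracket br) b c"
proof -
  define c where "c v = (THE x::real^6. (\<Sum>i\<in>UNIV. x $ i *\<^sub>R b i) = v)" for v
  have expand: "(\<Sum>i\<in>UNIV. c v $ i *\<^sub>R b i) = v" for v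
    unfolding c_def using standard_basis_expand[OF std] by (rule theI')
  \<comment> \<open>Uniqueness of the expansion: the identities for \<open>c\<close> below are
    proved by exhibiting an expansion.\<close>
  have eqI: "c v = x" if "(\<Sum>i\<in>UNIV. x $ i *\<^sub>R b i) = v" for v x
    using standard_basis_expand[OF std] expand that by metis
  have g2: "g2_basis (prod_bracket br) (UNIV \<times> {0}) (b 1) (b 2) (b 3)"
    "g2_basis (prod_bracket br) ({0} \<times> UNIV) (b 4) (b 5) (b 6)"
    using std by (auto simp: standard_basis_def)
  have "b i \<in> UNIV \<times> {0}" if "i \<in> {1,2,3}" for i
    using that g2(1) span_base[of "b i" "{b 1, b 2, b 3}"] unfolding g2_basis_def by blast
  then have s: "snd (b 1) = 0" "snd (b 2) = 0" "snd (b 3) = 0" by (auto simp: mem_Times_iff)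
  have "b i \<in> {0} \<times> UNIV" if "i \<in> {4,5,6}" for i
    using that g2(2) span_base[of "b i" "{b 4, b 5, b 6}"] unfolding g2_basis_def by blast
  then have f: "fst (b 4) = 0" "fst (b 5) = 0" "fst (b 6) = 0" by (auto simp: mem_Times_iff)
  note lie' = lie_bracket_prod[OF lie]
  note bl = lie_bracket_bilinear[OF lie] lie_bracket_bilinear[OF lie']
  have "g2_frame (prod_bracket br) b c"
  proof (rule g2_frame.intro)
    show "linear c"
    proof (rule linearI)
      show "c (v + w) = c v + c w" for v w
        by (rule eqI) (simp add: scaleR_left_distrib sum.distrib expand)
      show "c (r *\<^sub>R v) = r *\<^sub>R c v" for r v
        by (rule eqI) (simp flip: scaleR_scaleR scaleR_sum_right add: expand)
    qed
    show "(\<Sum>i\<in>UNIV. c v $ i *\<^sub>R b i) = v" for v by (rule expand)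
    show "c (b i) = axis i 1" for i
      by (rule eqI) (simp add: axis_def if_distrib[of "\<lambda>r. r *\<^sub>R _"] cong: if_cong)
    fix v w
    define v1 v2 where "v1 = c v $ 1 *\<^sub>R b 1 + c v $ 2 *\<^sub>R b 2 + c v $ 3 *\<^sub>R b 3"
      and "v2 = c v $ 4 *\<^sub>R b 4 + c v $ 5 *\<^sub>R b 5 + c v $ 6 *\<^sub>R b 6"
    define w1 w2 where "w1 = c w $ 1 *\<^sub>R b 1 + c w $ 2 *\<^sub>R b 2 + c w $ 3 *\<^sub>R b 3"
      and "w2 = c w $ 4 *\<^sub>R b 4 + c w $ 5 *\<^sub>R b 5 + c w $ 6 *\<^sub>R b 6"
    have "v = v1 + v2" "w = w1 + w2"
      using expand[of v] expand[of w] by (simp_all add: v1_def v2_def w1_def w2_def sum_6 add.assoc)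
    \<comment> \<open>The two copies commute: in each component one of the arguments is 0.\<close>
    moreover have "prod_bracket br v1 w2 = 0" "prod_bracket br v2 w1 = 0"
      by (simp_all add: v1_def v2_def w1_def w2_def prod_bracket_def s f bilinear_lzero[OF bl(1)]
          bilinear_rzero[OF bl(1)] zero_prod_def)
    ultimately have "prod_bracket br v w = prod_bracket br v1 w1 + prod_bracket br v2 w2"
      by (simp add: bilinear_ladd[OF bl(2)] bilinear_radd[OF bl(2)])
    then show "prod_bracket br v w = (c v $ 1 * c w $ 2 - c v $ 2 * c w $ 1) *\<^sub>R b 1
      + (c v $ 4 * c w $ 5 - c v $ 5 * c w $ 4) *\<^sub>R b 4"
      unfolding v1_def v2_def w1_def w2_def
      by (simp only: g2_basis_bracket[OF lie' g2(1)] g2_basis_bracket[OF lie' g2(2)])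
  qed
  then show thesis by (rule that)
qed

text \<open>The shift by 3 wraps around: from the indices 4, 5, 6 it produces the numerals 7, 8,
  9.\<close>

lemma numerals_mod_6: "(7::6) = 1" "(8::6) = 2" "(9::6) = 3"
  by simp_all

context g2_frame
begin

lemma coord_simps [simp]:
  "c (v + w) = c v + c w" "c (r *\<^sub>R v) = r *\<^sub>R c v" "c 0 = 0" "c (- v) = - c v" "c (v - w) = c v - c w"
  "c (b i) $ j = (if j = i then 1 else 0)"
  using linear_coord
  by (simp_all add: linear_add linear_scale linear_0 linear_neg linear_diff coord_basis axis_def)

lemma coord_eqI: "(\<And>i. c v $ i = c w $ i) \<Longrightarrow> v = w"
  by (metis expand vec_eq_iff)

lemma coord_bracket [simp]:
  "c (B v w) $ i = (if i = 1 then c v $ 1 * c w $ 2 - c v $ 2 * c w $ 1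
     else if i = 4 then c v $ 4 * c w $ 5 - c v $ 5 * c w $ 4 else 0)"
  by (simp add: bracket)

text \<open>The bracket formula is symmetric under exchange of the copies, which is the index shift
  by 3. Facts about \<open>b 1\<close> and the coordinates 1 and 2 thereby transfer to
  \<open>b 4\<close> and the coordinates 4 and 5.\<close>

lemma swap_frame: "g2_frame B (\<lambda>i. b (i + 3)) (\<lambda>v. \<chi> i. c v $ (i + 3))"
proof (rule g2_frame.intro)
  show "linear (\<lambda>v. \<chi> i. c v $ (i + 3))"
    by (rule linearI) (simp_all add: vec_eq_iff)
  show "(\<Sum>i\<in>UNIV. (\<chi> i. c v $ (i + 3)) $ i *\<^sub>R b (i + 3)) = v" for v
    using expand[of v] by (simp add: sum_6 numerals_mod_6 ac_simps)
  show "(\<chi> j. c (b (i + 3)) $ (j + 3)) = axis i 1" for i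
    by (simp add: vec_eq_iff axis_def)
  show "B v w = ((\<chi> i. c v $ (i + 3)) $ 1 * (\<chi> i. c w $ (i + 3)) $ 2
      - (\<chi> i. c v $ (i + 3)) $ 2 * (\<chi> i. c w $ (i + 3)) $ 1) *\<^sub>R b (1 + 3)
      + ((\<chi> i. c v $ (i + 3)) $ 4 * (\<chi> i. c w $ (i + 3)) $ 5
      - (\<chi> i. c v $ (i + 3)) $ 5 * (\<chi> i. c w $ (i + 3)) $ 4) *\<^sub>R b (4 + 3)" for v w
    by (simp add: bracket numerals_mod_6)
qed

text \<open>These vectors form the span of \<open>b 3\<close> and \<open>b 6\<close>, which is the
  center of \<open>B\<close>, since the bracket formula sees exactly the coordinates 1, 2, 4,
  5.\<close>

definition central :: "'v \<Rightarrow> bool" where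
  "central z \<longleftrightarrow> c z $ 1 = 0 \<and> c z $ 2 = 0 \<and> c z $ 4 = 0 \<and> c z $ 5 = 0"

section \<open>Integrable complex structures modulo the center\<close>

context
  fixes J assumes J: "integrable_complex_structure B J"
begin

lemma linear_J: "linear J" and J_J [simp]: "J (J v) = - v"
  and nijenhuis: "B v w + J (B (J v) w) + J (B v (J w)) - B (J v) (J w) = 0"
  using J by (auto simp: integrable_complex_structure_def)

lemma J_simps [simp]:
  "J (v + w) = J v + J w" "J (r *\<^sub>R v) = r *\<^sub>R J v" "J 0 = 0" "J (- v) = - J v" "J (v - w) = J v - J w"
  using linear_J by (simp_all add: linear_add linear_scale linear_0 linear_neg linear_diff)

lemma J_b1_not_derived: "c (J (b 1)) $ 2 \<noteq> 0 \<or> c (J (b 1)) $ 5 \<noteq> 0"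
proof (rule ccontr)
  assume A: "\<not> ?thesis"
  have "c (B (b 1) (b 2) + J (B (J (b 1)) (b 2)) + J (B (b 1) (J (b 2))) - B (J (b 1)) (J (b 2))) $ 1 = 0"
    by (simp add: nijenhuis)
  \<comment> \<open>The products with \<open>c (J (b 2)) $ 2\<close> cancel, and one plus a square
    is left.\<close>
  then have "1 + c (J (b 1)) $ 1 * c (J (b 1)) $ 1 = 0"
    using A by (simp add: bracket[of "J (b 1)" "b 2"] bracket[of "b 1"] algebra_simps)
  then show False by (smt (verit) zero_le_square)
qed

lemma central_J_1_2:
  assumes "central z"
  shows "c (J z) $ 1 = 0 \<and> c (J z) $ 2 = 0"
proof -
  have n: "J (B (J z) w) = B (J z) (J w)" for w
    using nijenhuis[of z w] assms by (simp add: bracket[of z] central_def)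
  have "c (J (B (J z) w)) $ 2 = 0" "c (J (B (J z) w)) $ 5 = 0" for w
    by (simp_all add: n)
  \<comment> \<open>For \<open>w\<close> equal to \<open>b 1\<close> and \<open>b 2\<close>,
    \<open>B (J z) w\<close> is \<open>b 1\<close> times minus coordinate 2 and times coordinate 1
    of \<open>J z\<close>, respectively. Its image under \<open>J\<close> has no coordinates 2 and
    5, while \<open>J (b 1)\<close> has at least one of them, so both factors vanish.\<close>
  from this[of "b 1"] this[of "b 2"] show ?thesis
    using J_b1_not_derived by (simp add: bracket) metis
qed

end
end

context g2_frame
begin
context
  fixes J assumes J: "integrable_complex_structure B J"
begin

interpretation swap: g2_frame B "\<lambda>i. b (i + 3)" "\<lambda>v. \<chi> i. c v $ (i + 3)"
  by (rule swap_frame)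

lemmas Js = J_simps[OF J]

lemma J_b4_not_derived: "c (J (b 4)) $ 2 \<noteq> 0 \<or> c (J (b 4)) $ 5 \<noteq> 0"
  using swap.J_b1_not_derived[OF J] by (auto simp: numerals_mod_6)

lemma central_J:
  assumes "central z" shows "central (J z)"
  using central_J_1_2[OF J assms] swap.central_J_1_2[OF J, of z] assms
  by (simp add: central_def swap.central_def numerals_mod_6)

lemma J_preserves_factors:
  "c (J (b 1)) $ 4 = 0 \<and> c (J (b 1)) $ 5 = 0 \<and> c (J (b 1)) $ 2 \<noteq> 0 \<and>
   c (J (b 4)) $ 1 = 0 \<and> c (J (b 4)) $ 2 = 0 \<and> c (J (b 4)) $ 5 \<noteq> 0"
proof -
  define x1 x2 y1 y2 where "x1 = c (J (b 1)) $ 1" "x2 = c (J (b 1)) $ 2"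
    "y1 = c (J (b 1)) $ 4" "y2 = c (J (b 1)) $ 5"
  define u1 u2 v1 v2 where "u1 = c (J (b 4)) $ 1" "u2 = c (J (b 4)) $ 2"
    "v1 = c (J (b 4)) $ 4" "v2 = c (J (b 4)) $ 5"
  note defs = x1_x2_y1_y2_def u1_u2_v1_v2_def
  have N: "c (B (b 1) (b 4) + J (B (J (b 1)) (b 4)) + J (B (b 1) (J (b 4))) - B (J (b 1)) (J (b 4))) $ i = 0" for i
    by (simp add: nijenhuis[OF J])
  \<comment> \<open>Coordinates 1, 2, 4, 5 of the identity \<open>u2 *\<^sub>R J (b 1) - y2
    *\<^sub>R J (b 4) = (x1 * u2 - x2 * u1) *\<^sub>R b 1 + (y1 * v2 - y2 * v1) *\<^sub>R b
    4\<close>.\<close>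
  have e: "u1 * (x2 - y2) = 0" "u2 * (x2 - y2) = 0" "y1 * (u2 - v2) = 0" "y2 * (u2 - v2) = 0"
    using N[of 1] N[of 2] N[of 4] N[of 5]
    by (simp_all add: Js bracket[of "J (b 1)" "b 4"] bracket[of "b 1"] defs algebra_simps)
  have nd: "x2 \<noteq> 0 \<or> y2 \<noteq> 0" "u2 \<noteq> 0 \<or> v2 \<noteq> 0"
    using J_b1_not_derived[OF J] J_b4_not_derived by (simp_all add: defs)
  have y2: "y2 = 0"
  proof (rule ccontr)
    assume y2: "y2 \<noteq> 0"
    with e nd have eq: "v2 = u2" "u2 \<noteq> 0" "x2 = y2" by auto
    \<comment> \<open>The coefficients of \<open>w\<close> make the coordinates 2 and 5 of
      \<open>J w\<close> cancel, so \<open>J w\<close> is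
      \<open>p *\<^sub>R b 1 + q *\<^sub>R b 4\<close> modulo the center.\<close>
    define w where "w = u2 *\<^sub>R b 1 - y2 *\<^sub>R b 4"
    define p where "p = u2 * x1 - y2 * u1"
    define q where "q = u2 * y1 - y2 * v1"
    have "central (J w - p *\<^sub>R b 1 - q *\<^sub>R b 4)"
      using eq by (simp add: central_def w_def p_def q_def Js defs)
    then have "central (J (J w - p *\<^sub>R b 1 - q *\<^sub>R b 4))" by (rule central_J)
    \<comment> \<open>Coordinates 1 and 2 of \<open>J (J w) = - w\<close>. Multiplying the first
      equation by \<open>u2\<close> and eliminating \<open>q * u2\<close> with the second leaves a
      vanishing sum of two squares.\<close>
    then have "- u2 = p * x1 + q * u1" "p * x2 + q * u2 = 0"
      by (simp_all add: central_def Js J_J[OF J] w_def defs)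
    then have "u2 * u2 + p * p = 0" unfolding p_def eq(3) by algebra
    then show False using eq(2) by (simp add: sum_squares_eq_zero_iff)
  qed
  \<comment> \<open>Now \<open>x2 \<noteq> 0\<close>, which forces \<open>u2 = 0\<close> and
    \<open>u1 = 0\<close>; then \<open>v2 \<noteq> 0\<close>, which forces
    \<open>y1 = 0\<close>.\<close>
  moreover from this have "u2 = 0" using e nd by auto
  ultimately show ?thesis using e nd by (simp add: defs)
qed

end
end

section \<open>Normal form of the matrix\<close>

lemma has_matrix_g2I:
  assumes J: "linear J" and sq: "\<And>v. J (J v) = - v" and Y: "Y \<noteq> 0" "Y' \<noteq> 0"
    and f1: "J (f 1) = X *\<^sub>R f 1 + Y *\<^sub>R f 2 + (k * (l - X)) *\<^sub>R f 3 + k *\<^sub>R f 6"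
    and f3: "J (f 3) = l *\<^sub>R f 3 + f 6"
    and f4: "J (f 4) = X' *\<^sub>R f 4 + Y' *\<^sub>R f 5 + (k' * (-1 - l\<^sup>2)) *\<^sub>R f 3 + (k' * (- l - X')) *\<^sub>R f 6"
  shows "has_matrix J f (g2_matrix l X Y k X' Y' k')"
proof -
  note Js = linear_add[OF J] linear_scale[OF J] linear_diff[OF J] linear_neg[OF J]
  \<comment> \<open>The given columns are solved for \<open>f 6\<close>, \<open>f 2\<close> and
    \<open>f 5\<close> in turn; applying \<open>J\<close> and \<open>J (J v) = - v\<close> yields
    the other three columns.\<close>
  have f6: "J (f 6) = (- 1 - l\<^sup>2) *\<^sub>R f 3 - l *\<^sub>R f 6"
  proof -
    have "J (f 6) = J (J (f 3) - l *\<^sub>R f 3)" unfolding f3 by simp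
    also have "\<dots> = - f 3 - l *\<^sub>R J (f 3)" by (simp only: Js sq)
    finally show ?thesis unfolding f3 by (simp add: algebra_simps power2_eq_square)
  qed
  have "Y *\<^sub>R J (f 2) = J (J (f 1) - X *\<^sub>R f 1 - (k * (l - X)) *\<^sub>R f 3 - k *\<^sub>R f 6)"
    unfolding f1 by (simp add: Js)
  also have "\<dots> = - f 1 - X *\<^sub>R J (f 1) - (k * (l - X)) *\<^sub>R J (f 3) - k *\<^sub>R J (f 6)"
    by (simp only: Js sq)
  also have "\<dots> = (- 1 - X\<^sup>2) *\<^sub>R f 1 - (Y * X) *\<^sub>R f 2 + (k * (1 + X\<^sup>2)) *\<^sub>R f 3"
    unfolding f1 f3 f6 by (simp add: algebra_simps power2_eq_square)
  also have "\<dots> = Y *\<^sub>R (((-1 - X\<^sup>2) / Y) *\<^sub>R f 1 - X *\<^sub>R f 2 + (k * ((1 + X\<^sup>2) / Y)) *\<^sub>R f 3)"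
    using Y by (simp add: scaleR_right_diff_distrib scaleR_right_distrib)
  finally have f2: "J (f 2) = ((-1 - X\<^sup>2) / Y) *\<^sub>R f 1 - X *\<^sub>R f 2 + (k * ((1 + X\<^sup>2) / Y)) *\<^sub>R f 3"
    using Y by simp
  have "Y' *\<^sub>R J (f 5) = J (J (f 4) - X' *\<^sub>R f 4 - (k' * (-1 - l\<^sup>2)) *\<^sub>R f 3 - (k' * (- l - X')) *\<^sub>R f 6)"
    unfolding f4 by (simp add: Js)
  also have "\<dots> = - f 4 - X' *\<^sub>R J (f 4) - (k' * (-1 - l\<^sup>2)) *\<^sub>R J (f 3) - (k' * (- l - X')) *\<^sub>R J (f 6)"
    by (simp only: Js sq)
  also have "\<dots> = (- 1 - X'\<^sup>2) *\<^sub>R f 4 - (Y' * X') *\<^sub>R f 5 + (k' * (1 + X'\<^sup>2)) *\<^sub>R f 6"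
    unfolding f4 f3 f6 by (simp add: algebra_simps power2_eq_square)
  also have "\<dots> = Y' *\<^sub>R (((-1 - X'\<^sup>2) / Y') *\<^sub>R f 4 - X' *\<^sub>R f 5 + (k' * ((1 + X'\<^sup>2) / Y')) *\<^sub>R f 6)"
    using Y by (simp add: scaleR_right_diff_distrib scaleR_right_distrib)
  finally have f5: "J (f 5) = ((-1 - X'\<^sup>2) / Y') *\<^sub>R f 4 - X' *\<^sub>R f 5 + (k' * ((1 + X'\<^sup>2) / Y')) *\<^sub>R f 6"
    using Y by simp
  show ?thesis
    unfolding has_matrix_def forall_6
    by (simp add: sum_6 g2_matrix_def f1 f2 f3 f4 f5 f6)
qed

lemma (in g2_frame) normal_form:
  assumes J: "integrable_complex_structure B J"
  obtains l X Y k X' Y' k' m t t' where "m \<noteq> 0" "Y \<noteq> 0" "Y' \<noteq> 0"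
    "has_matrix J (($) (vector [b 1, b 2 + t *\<^sub>R b 3, b 3, b 4, b 5 + t' *\<^sub>R b 6, m *\<^sub>R b 6]))
      (g2_matrix l X Y k X' Y' k')"
proof -
  note F = J_preserves_factors[OF J]
  \<comment> \<open>Replacing \<open>b 6\<close> by \<open>m *\<^sub>R b 6\<close> turns the entry
    in row 6, column 3 into 1.\<close>
  define l m where "l = c (J (b 3)) $ 3" and "m = c (J (b 3)) $ 6"
  \<comment> \<open>\<open>k\<close> is the coefficient of \<open>J (b 1)\<close> at the rescaled
    vector \<open>m *\<^sub>R b 6\<close>; \<open>k'\<close> is solved for from the entry in row 3,
    column 4.\<close>
  define X Y k where "X = c (J (b 1)) $ 1" and "Y = c (J (b 1)) $ 2" and "k = c (J (b 1)) $ 6 / m"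
  define X' Y' k' where "X' = c (J (b 4)) $ 4" and "Y' = c (J (b 4)) $ 5"
    and "k' = c (J (b 4)) $ 3 / (- 1 - l\<^sup>2)"
  \<comment> \<open>With \<open>k\<close> and \<open>k'\<close> fixed, one central coefficient of
    \<open>J (b 1)\<close> and one of \<open>J (b 4)\<close> are still arbitrary. The shifts of
    \<open>b 2\<close> and \<open>b 5\<close> contribute \<open>Y * t\<close> and
    \<open>Y' * t'\<close> to them, and \<open>t\<close>, \<open>t'\<close> are solved for
    accordingly.\<close>
  define t where "t = (c (J (b 1)) $ 3 - k * (l - X)) / Y"
  define t' where "t' = (c (J (b 4)) $ 6 - k' * (- l - X') * m) / Y'"
  have "central (J (b 3))" by (rule central_J[OF J]) (simp add: central_def)
  then have J3: "J (b 3) = l *\<^sub>R b 3 + m *\<^sub>R b 6"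
    using expand[of "J (b 3)"] by (simp add: sum_6 central_def l_def m_def)
  have l: "- 1 - l\<^sup>2 \<noteq> 0" by (smt (verit) zero_le_power2)
  \<comment> \<open>Otherwise \<open>b 3\<close> would be an eigenvector of \<open>J\<close> with
    real eigenvalue \<open>l\<close>, whose square would be -1.\<close>
  have m: "m \<noteq> 0"
  proof
    assume "m = 0"
    then have "- b 3 = l *\<^sub>R l *\<^sub>R b 3" using J_J[OF J, of "b 3"] J3 by (simp add: J_simps[OF J])
    then have "c (- b 3) $ 3 = c (l *\<^sub>R l *\<^sub>R b 3) $ 3" by simp
    then show False using l by (simp add: power2_eq_square)
  qed
  have Y: "Y \<noteq> 0" "Y' \<noteq> 0" using F by (simp_all add: Y_def Y'_def)
  let ?f = "($) (vector [b 1, b 2 + t *\<^sub>R b 3, b 3, b 4, b 5 + t' *\<^sub>R b 6, m *\<^sub>R b 6])"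
  have "J (b 1) = X *\<^sub>R b 1 + Y *\<^sub>R b 2 + (k * (l - X) + Y * t) *\<^sub>R b 3 + (k * m) *\<^sub>R b 6"
    using expand[of "J (b 1)"] F Y m by (simp add: sum_6 X_def Y_def k_def t_def)
  moreover have "k' * (-1 - l\<^sup>2) = c (J (b 4)) $ 3" "k' * (- l - X') * m + Y' * t' = c (J (b 4)) $ 6"
    using l Y by (simp_all add: k'_def t'_def)
  then have "J (b 4) = X' *\<^sub>R b 4 + Y' *\<^sub>R b 5 + (k' * (-1 - l\<^sup>2)) *\<^sub>R b 3
      + (k' * (- l - X') * m + Y' * t') *\<^sub>R b 6"
    using expand[of "J (b 4)"] F by (simp add: sum_6 X'_def Y'_def ac_simps)
  ultimately have "has_matrix J ?f (g2_matrix l X Y k X' Y' k')"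
    using linear_J[OF J] J_J[OF J] Y J3 by (intro has_matrix_g2I) (simp_all add: algebra_simps)
  then show thesis using that m Y by blast
qed

section \<open>The converse: maps given by a matrix of this form\<close>

lemma (in g2_frame) has_matrix_unique:
  fixes M :: "real^6^6"
  shows "\<exists>!J. linear J \<and> has_matrix J b M"
proof (rule ex1I)
  let ?J = "\<lambda>v. \<Sum>j\<in>UNIV. c v $ j *\<^sub>R (\<Sum>i\<in>UNIV. M $ i $ j *\<^sub>R b i)"
  show "linear ?J \<and> has_matrix ?J b M"
  proof
    show "linear ?J"
      by (rule linearI) (simp_all add: scaleR_left_distrib sum.distrib flip: scaleR_scaleR scaleR_sum_right)
    show "has_matrix ?J b M"
      by (simp add: has_matrix_def if_distrib[of "\<lambda>r. r *\<^sub>R _"] cong: if_cong)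
  qed
  fix J assume J: "linear J \<and> has_matrix J b M"
  show "J = ?J"
  proof
    fix v
    have "J v = J (\<Sum>j\<in>UNIV. c v $ j *\<^sub>R b j)" by (simp only: expand)
    also have "\<dots> = ?J v"
      using J by (simp add: has_matrix_def linear_sum linear_scale)
    finally show "J v = ?J v" .
  qed
qed

lemma (in g2_frame) coord_has_matrix:
  assumes "linear J" and "has_matrix J b M"
  shows "c (J v) = M *v c v"
proof -
  have "J v = J (\<Sum>j\<in>UNIV. c v $ j *\<^sub>R b j)" by (simp only: expand)
  also have "\<dots> = (\<Sum>j\<in>UNIV. c v $ j *\<^sub>R (\<Sum>i\<in>UNIV. M $ i $ j *\<^sub>R b i))"
    using assms by (simp add: has_matrix_def linear_sum linear_scale)
  finally show ?thesis
    by (simp add: vec_eq_iff matrix_vector_mult_def linear_sum[OF linear_coord] coord_basis axis_def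
        if_distrib[of "\<lambda>r. _ * r"] mult.commute cong: if_cong)
qed

lemma (in g2_frame) integrable_g2_matrix:
  assumes J: "linear J" and M: "has_matrix J b (g2_matrix l X Y k X' Y' k')"
    and Y: "Y \<noteq> 0" "Y' \<noteq> 0"
  shows "integrable_complex_structure B J"
proof -
  \<comment> \<open>Naming the quotients makes all later identities polynomial;
    \<open>T * Y = 1 + X * X\<close> says that the block with rows \<open>X, - T\<close> and
    \<open>Y, - X\<close> has determinant 1.\<close>
  define T T' where "T = (1 + X\<^sup>2) / Y" and "T' = (1 + X'\<^sup>2) / Y'"
  have T: "T * Y = 1 + X * X" "T' * Y' = 1 + X' * X'"
    using Y by (simp_all add: T_def T'_def power2_eq_square)
  have T': "(-1 - X\<^sup>2) / Y = - T" "(-1 - X'\<^sup>2) / Y' = - T'"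
    unfolding T_def T'_def minus_divide_left by simp_all
  have cJ:
    "c (J v) $ 1 = X * c v $ 1 - T * c v $ 2"
    "c (J v) $ 2 = Y * c v $ 1 - X * c v $ 2"
    "c (J v) $ 3 = k * (l - X) * c v $ 1 + k * T * c v $ 2 + l * c v $ 3 + k' * (-1 - l * l) * c v $ 4
       + (-1 - l * l) * c v $ 6"
    "c (J v) $ 4 = X' * c v $ 4 - T' * c v $ 5"
    "c (J v) $ 5 = Y' * c v $ 4 - X' * c v $ 5"
    "c (J v) $ 6 = k * c v $ 1 + c v $ 3 + k' * (- l - X') * c v $ 4 + k' * T' * c v $ 5 - l * c v $ 6" for v
    unfolding coord_has_matrix[OF J M] matrix_vector_mult_def g2_matrix_def T'
    by (simp_all add: sum_6 T_def T'_def power2_eq_square)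
  have "J (J v) = - v" for v
  proof -
    have "\<forall>i. c (J (J v)) $ i = - (c v $ i)"
      unfolding forall_6 cJ by (intro conjI) (use T in algebra)+
    then show ?thesis by (intro coord_eqI) simp
  qed
  moreover have "B v w + J (B (J v) w) + J (B v (J w)) - B (J v) (J w) = 0" for v w
  proof -
    \<comment> \<open>Each coordinate of the bracket is an area form on its plane. Letting a 2x2
      block act on one argument at a time and adding multiplies that form by the trace, here
      0.\<close>
    have tr: "B (J v) w + B v (J w) = 0"
      by (simp add: bracket cJ) (simp add: algebra_simps)
    \<comment> \<open>Letting the block act on both arguments multiplies the area form by the
      determinant, here 1.\<close>
    have det: "B (J v) (J w) = B v w"
    proof -
      have "c (J v) $ 1 * c (J w) $ 2 - c (J v) $ 2 * c (J w) $ 1 = c v $ 1 * c w $ 2 - c v $ 2 * c w $ 1"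
        "c (J v) $ 4 * c (J w) $ 5 - c (J v) $ 5 * c (J w) $ 4 = c v $ 4 * c w $ 5 - c v $ 5 * c w $ 4"
        unfolding cJ using T by algebra+
      then show ?thesis by (simp add: bracket)
    qed
    have "J (B (J v) w) + J (B v (J w)) = 0"
      using tr J by (metis linear_add linear_0)
    then show ?thesis using det by (simp add: add.assoc)
  qed
  ultimately show ?thesis using J by (simp add: integrable_complex_structure_def)
qed

theorem proposition5:
  fixes br :: "'g::real_vector \<Rightarrow> 'g \<Rightarrow> 'g"
  assumes "is_g2 br"
  shows "(\<forall>J. integrable_complex_structure (prod_bracket br) J \<longrightarrow>
            (\<exists>b l X Y k X' Y' k'. standard_basis br b \<and> Y \<noteq> 0 \<and> Y' \<noteq> 0 \<and>
               has_matrix J b (g2_matrix l X Y k X' Y' k')))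
       \<and> (\<forall>b l X Y k X' Y' k'. standard_basis br b \<and> Y \<noteq> 0 \<and> Y' \<noteq> 0 \<longrightarrow>
            (\<exists>!J. linear J \<and> has_matrix J b (g2_matrix l X Y k X' Y' k')) \<and>
            (\<forall>J. linear J \<and> has_matrix J b (g2_matrix l X Y k X' Y' k') \<longrightarrow>
               integrable_complex_structure (prod_bracket br) J))"
proof -
  obtain e1 e2 e3 where lie: "lie_bracket br" and e: "g2_basis br UNIV e1 e2 e3"
    using assms by (auto simp: is_g2_def)
  note lie' = lie_bracket_prod[OF lie]
  show ?thesis
  proof (intro conjI allI impI; (elim conjE)?)
    fix J assume J: "integrable_complex_structure (prod_bracket br) J"
    obtain b where b: "standard_basis br b" using g2_basis_prod[OF lie e] by blast
    obtain c where "g2_frame (prod_bracket br) b c" using standard_basis_frame[OF lie b] .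
    then obtain l X Y k X' Y' k' m t t' where n: "m \<noteq> 0" "Y \<noteq> 0" "Y' \<noteq> 0"
      "has_matrix J (($) (vector [b 1, b 2 + t *\<^sub>R b 3, b 3, b 4, b 5 + t' *\<^sub>R b 6, m *\<^sub>R b 6]))
        (g2_matrix l X Y k X' Y' k')"
      using J by (rule g2_frame.normal_form)
    \<comment> \<open>The basis change has scale 1 on the first copy and scale \<open>m\<close> on
      the second.\<close>
    have "standard_basis br (($) (vector [b 1, b 2 + t *\<^sub>R b 3, b 3, b 4, b 5 + t' *\<^sub>R b 6, m *\<^sub>R b 6]))"
      using b g2_basis_change[OF lie', where m = 1] g2_basis_change[OF lie' _ n(1)]
      by (simp add: standard_basis_def)
    then show "\<exists>b l X Y k X' Y' k'. standard_basis br b \<and> Y \<noteq> 0 \<and> Y' \<noteq> 0 \<and>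
               has_matrix J b (g2_matrix l X Y k X' Y' k')"
      using n by blast
  next
    fix b :: "6 \<Rightarrow> 'g \<times> 'g" and l X Y k X' Y' k' :: real
    assume b: "standard_basis br b" and Y: "Y \<noteq> 0" "Y' \<noteq> 0"
    obtain c where c: "g2_frame (prod_bracket br) b c" using standard_basis_frame[OF lie b] .
    \<comment> \<open>A map with this matrix does exist, so the integrability claim that follows is
      not vacuous.\<close>
    show "\<exists>!J. linear J \<and> has_matrix J b (g2_matrix l X Y k X' Y' k')"
      using c by (rule g2_frame.has_matrix_unique)
    fix J assume "linear J" "has_matrix J b (g2_matrix l X Y k X' Y' k')"
    then show "integrable_complex_structure (prod_bracket br) J"
      using g2_frame.integrable_g2_matrix[OF c] Y by blast
  qed
qed

end
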